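(* Let $k\ge2$ be an integer and $b=\frac12(\lceil k/2\rceil-1)$. There is a constant $C=C_k>0$ (depending only on $k$) such that the following holds. Let $\mathbf v_0\in\mathbb S^{n-1}$, let $\mathbf X=\beta\,\mathbf v_0^{\otimes k}+\mathbf Z$ with $\mathbf Z\in\bigotimes^k\mathbb R^n$ a symmetric standard normal noise tensor, and let $\mathbf w=\mathbf w(\mathbf X)\in\mathbb R^{n^{\lfloor k/2\rfloor}}$ be the top (unit-norm) right singular vector of the unfolding $\mathsf{Mat}(\mathbf X)\in\mathbb R^{n^{\lceil k/2\rceil}\times n^{\lfloor k/2\rfloor}}$. If $\beta\ge5\,k^{1/2}n^{b}$, then with probability at least $1-n^{-2}$, $$\mathrm{Loss}\Big(\mathbf w,\mathrm{vec}\big(\mathbf v_0^{\otimes\lfloor k/2\rfloor}\big)\Big)\le\frac{C\,k\,n^{2b}}{\beta^2}.$$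
   Context: $\mathbb S^{n-1}$ is the unit sphere of $\mathbb R^n$; $\mathbf v^{\otimes k}$ has entries $\mathbf v_{i_1}\cdots\mathbf v_{i_k}$. The symmetric standard normal noise tensor is $$\mathbf Z_{i_1,\dots,i_k}=\frac1{k!}\sqrt{\frac kn}\sum_{\pi\in\mathfrak S_k}\mathbf G_{i_{\pi(1)},\dots,i_{\pi(k)}},$$ with $\mathbf G\in\bigotimes^k\mathbb R^n$ having i.i.d. $\mathsf N(0,1)$ entries. Unfolding: for $0\le q\le k$, $\mathsf{Mat}_q:\bigotimes^k\mathbb R^n\to\mathbb R^{n^q\times n^{k-q}}$ is defined by $[\mathsf{Mat}_q(\mathbf X)]_{a,c}=\mathbf X_{i_1,\dots,i_k}$ with $a=1+\sum_{j=1}^q(i_j-1)n^{j-1}$ and $c=1+\sum_{j=q+1}^k(i_j-1)n^{j-q-1}$. We write $\mathsf{Mat}=\mathsf{Mat}_{\lceil k/2\rceil}$. For a tensor $\mathbf T\in\bigotimes^m\mathbb R^n$, $\mathrm{vec}(\mathbf T)\in\mathbb R^{n^m}$ is the vector with entry $\mathbf T_{i_1,\dots,i_m}$ at position $1+\sum_{j=1}^m(i_j-1)n^{j-1}$. For unit vectors $\mathbf u,\mathbf u'$ of the same dimension, $\mathrm{Loss}(\mathbf u,\mathbf u')=\min(\|\mathbf u-\mathbf u'\|_2^2,\|\mathbf u+\mathbf u'\|_2^2)=2-2|\langle\mathbf u,\mathbf u'\rangle|$. *)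

theory Defs
  imports
    "HOL-Probability.Probability"
    "HOL-Combinatorics.Permutations"
    "Jordan_Normal_Form.Matrix"
begin

unbundle no vec_syntax
unbundle no inner_syntax
section \<open>Tensors, unfolding and vectorization\<close>

text \<open>
  A tensor of order \<open>k\<close> over \<open>\<real>\<^sup>n\<close> is a function on index lists; only its values on
  \<open>tensor_index n k\<close> matter. Indices, matrix rows and columns all start at \<open>0\<close>, so the position
  \<open>1 + (\<Sum>j. (i\<^sub>j - 1) n\<^sup>j\<^sup>-\<^sup>1)\<close> of the 1-based convention becomes \<open>\<Sum>j. i\<^sub>j n\<^sup>j\<close> (least
  significant digit first).
\<close>

type_synonym tensor = "nat list \<Rightarrow> real"

definition tensor_index :: "nat \<Rightarrow> nat \<Rightarrow> nat list set" where
  "tensor_index n k = {is. set is \<subseteq> {..<n} \<and> length is = k}"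

definition index_pos :: "nat \<Rightarrow> nat list \<Rightarrow> nat" where
  "index_pos n is = (\<Sum>j<length is. is ! j * n ^ j)"

definition index_of_pos :: "nat \<Rightarrow> nat \<Rightarrow> nat \<Rightarrow> nat list" where
  "index_of_pos n m a = map (\<lambda>j. a div n ^ j mod n) [0..<m]"

definition Mat :: "nat \<Rightarrow> nat \<Rightarrow> nat \<Rightarrow> tensor \<Rightarrow> real mat" where
  "Mat n k q T = mat (n ^ q) (n ^ (k - q))
     (\<lambda>(a, c). T (index_of_pos n q a @ index_of_pos n (k - q) c))"

definition vectorize :: "nat \<Rightarrow> nat \<Rightarrow> tensor \<Rightarrow> real vec" where
  "vectorize n m T = vec (n ^ m) (\<lambda>a. T (index_of_pos n m a))"

text \<open>\<open>index_of_pos\<close> inverts \<open>index_pos\<close>, so the entries are located as intended.\<close>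

lemma index_pos_Nil [simp]: "index_pos n [] = 0"
  by (simp add: index_pos_def)

lemma index_pos_Cons: "index_pos n (i # is) = i + n * index_pos n is"
  by (simp add: index_pos_def sum.lessThan_Suc_shift sum_distrib_left algebra_simps
      del: sum.lessThan_Suc)

lemma index_of_pos_index_pos:
  assumes "is \<in> tensor_index n m"
  shows "index_of_pos n m (index_pos n is) = is"
  using assms
proof (induction "is" arbitrary: m)
  case Nil
  then show ?case by (simp add: tensor_index_def index_of_pos_def)
next
  case (Cons i "is")
  then obtain m' where m: "m = Suc m'" and i: "i < n" and "is": "is \<in> tensor_index n m'"
    by (auto simp: tensor_index_def)
  have "index_of_pos n (Suc m') (index_pos n (i # is))
      = i # index_of_pos n m' (index_pos n is)"
    using i unfolding index_of_pos_def map_upt_Suc index_pos_Cons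
    by (simp add: div_mult2_eq)
  then show ?case using Cons.IH[OF "is"] m by simp
qed

lemma index_pos_less:
  assumes "is \<in> tensor_index n m"
  shows "index_pos n is < n ^ m"
  using assms
proof (induction "is" arbitrary: m)
  case Nil
  then show ?case by (simp add: tensor_index_def)
next
  case (Cons i "is")
  then obtain m' where m: "m = Suc m'" and i: "i < n" and "is": "is \<in> tensor_index n m'"
    by (auto simp: tensor_index_def)
  have "Suc (index_pos n is) \<le> n ^ m'" using Cons.IH[OF "is"] by simp
  then have "n * Suc (index_pos n is) \<le> n * n ^ m'" by (rule mult_le_mono2)
  then show ?case using i m by (simp add: index_pos_Cons)
qed

lemma Mat_entry:
  assumes "is \<in> tensor_index n k" "q \<le> k"
  shows "Mat n k q T $$ (index_pos n (take q is), index_pos n (drop q is)) = T is"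
proof -
  have "take q is \<in> tensor_index n q" "drop q is \<in> tensor_index n (k - q)"
    using assms by (auto simp: tensor_index_def dest: in_set_takeD in_set_dropD)
  then show ?thesis
    by (simp add: Mat_def index_pos_less index_of_pos_index_pos)
qed

lemma vectorize_entry:
  assumes "is \<in> tensor_index n m"
  shows "vectorize n m T $ index_pos n is = T is"
  using assms by (simp add: vectorize_def index_pos_less index_of_pos_index_pos)

text \<open>The order of the tensor power is the length of the index list.\<close>

definition tensor_power :: "real vec \<Rightarrow> tensor" where
  "tensor_power v = (\<lambda>is. \<Prod>i\<leftarrow>is. v $ i)"


section \<open>Unit vectors, loss, singular vectors\<close>

definition vnorm :: "real vec \<Rightarrow> real" where
  "vnorm v = sqrt (v \<bullet> v)"

definition unit_sphere :: "nat \<Rightarrow> real vec set" where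
  "unit_sphere n = {v \<in> carrier_vec n. vnorm v = 1}"

definition Loss :: "real vec \<Rightarrow> real vec \<Rightarrow> real" where
  "Loss u u' = min ((vnorm (u - u'))\<^sup>2) ((vnorm (u + u'))\<^sup>2)"

definition singular_triple :: "real mat \<Rightarrow> real \<Rightarrow> real vec \<Rightarrow> real vec \<Rightarrow> bool" where
  "singular_triple A \<sigma> u w \<longleftrightarrow>
     0 \<le> \<sigma> \<and> u \<in> unit_sphere (dim_row A) \<and> w \<in> unit_sphere (dim_col A) \<and>
     A *\<^sub>v w = \<sigma> \<cdot>\<^sub>v u \<and> transpose_mat A *\<^sub>v u = \<sigma> \<cdot>\<^sub>v w"

text \<open>The top singular vector is unique only up to sign, and not even that when the largest
  singular value is multiple; hence a predicate.\<close>

definition top_right_singular_vector :: "real mat \<Rightarrow> real vec \<Rightarrow> bool" where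
  "top_right_singular_vector A w \<longleftrightarrow>
     (\<exists>\<sigma> u. singular_triple A \<sigma> u w \<and>
        (\<forall>\<sigma>' u' w'. singular_triple A \<sigma>' u' w' \<longrightarrow> \<sigma>' \<le> \<sigma>))"


section \<open>The spiked tensor model\<close>

text \<open>The law of a tensor \<open>G\<close> with i.i.d. standard normal entries; the noise and the observation
  are random variables on this space.\<close>

definition gaussian_tensor :: "nat \<Rightarrow> nat \<Rightarrow> tensor measure" where
  "gaussian_tensor n k = Pi\<^sub>M (tensor_index n k) (\<lambda>_. density lborel std_normal_density)"

definition sym_noise :: "nat \<Rightarrow> nat \<Rightarrow> tensor \<Rightarrow> tensor" where
  "sym_noise n k G = (\<lambda>is. 1 / fact k * sqrt (real k / real n) *
     (\<Sum>\<pi> | \<pi> permutes {..<k}. G (permute_list \<pi> is)))"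

definition spiked_tensor :: "nat \<Rightarrow> nat \<Rightarrow> real \<Rightarrow> real vec \<Rightarrow> tensor \<Rightarrow> tensor" where
  "spiked_tensor n k \<beta> v\<^sub>0 G = (\<lambda>is. \<beta> * tensor_power v\<^sub>0 is + sym_noise n k G is)"

text \<open>Working on this canonical space is no restriction: every family of i.i.d. standard normal
  entries, on any probability space, has this joint law, and events pull back along it.\<close>

lemma (in prob_space) distr_iid_std_normal:
  fixes G :: "nat list \<Rightarrow> 'a \<Rightarrow> real"
  assumes "n > 0"
    and indep: "indep_vars (\<lambda>_. borel) G (tensor_index n k)"
    and normal: "\<And>is. is \<in> tensor_index n k \<Longrightarrow> distributed M lborel (G is) std_normal_density"
  shows "distr M (Pi\<^sub>M (tensor_index n k) (\<lambda>_. borel)) (\<lambda>\<omega>. \<lambda>is\<in>tensor_index n k. G is \<omega>)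
    = gaussian_tensor n k"
proof -
  let ?I = "tensor_index n k"
  have "replicate k 0 \<in> ?I" using \<open>n > 0\<close> by (auto simp: tensor_index_def)
  then have ne: "?I \<noteq> {}" by blast
  have rv: "random_variable borel (G is)" if "is \<in> ?I" for "is"
    using indep that by (auto simp: indep_vars_def)
  have "distr M (Pi\<^sub>M ?I (\<lambda>_. borel)) (\<lambda>\<omega>. \<lambda>is\<in>?I. G is \<omega>)
      = (\<Pi>\<^sub>M is\<in>?I. distr M borel (G is))"
    using indep_vars_iff_distr_eq_PiM'[OF ne rv] indep by auto
  also have "\<dots> = gaussian_tensor n k"
    unfolding gaussian_tensor_def
  proof (rule PiM_cong[OF refl])
    fix "is" assume "is \<in> ?I"
    from distributed_distr_eq_density[OF normal[OF this]]
    show "distr M borel (G is) = density lborel std_normal_density"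
      by (simp cong: distr_cong)
  qed
  finally show ?thesis .
qed

end

theory Submission
  imports Defs
begin

text \<open>
  The unfolding of the observation is a rank-one spike \<open>\<beta> u v\<^sup>T\<close> plus the unfolded noise. If the noise has
  operator norm at most \<open>\<epsilon>\<close>, a Wedin-type argument bounds the loss of the top right singular vector
  by \<open>8 \<epsilon>\<^sup>2 / \<beta>\<^sup>2\<close>. The operator norm is controlled by a union bound over grid nets of the two unit
  balls: for fixed \<open>x\<close> and \<open>y\<close> the bilinear form of the noise is a linear form in the Gaussian
  entries, and its variance is at most \<open>(k / n) \<parallel>x\<parallel>\<^sup>2 \<parallel>y\<parallel>\<^sup>2\<close> because symmetrization is self-adjoint and
  contracts the Euclidean norm.
\<close>

section \<open>Singular vectors of a perturbed spike\<close>

lemma scalar_prod_sum: "x \<in> carrier_vec n \<Longrightarrow> y \<in> carrier_vec n \<Longrightarrow> x \<bullet> y = (\<Sum>i<n. x $ i * y $ i)"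
  by (simp add: scalar_prod_def atLeast0LessThan)

lemma vnorm_eq_L2_set: "x \<in> carrier_vec n \<Longrightarrow> vnorm x = L2_set (($) x) {..<n}"
  by (simp add: vnorm_def L2_set_def scalar_prod_sum power2_eq_square)

lemma vnorm_nonneg [simp]: "0 \<le> vnorm x"
  by (simp add: vnorm_def scalar_prod_def sum_nonneg)

lemma vnorm_square: "(vnorm x)\<^sup>2 = x \<bullet> x"
  by (simp add: vnorm_def scalar_prod_def sum_nonneg)

lemma vnorm_square_sum: "x \<in> carrier_vec n \<Longrightarrow> (vnorm x)\<^sup>2 = (\<Sum>i<n. (x $ i)\<^sup>2)"
  by (simp add: vnorm_square scalar_prod_sum) (simp add: power2_eq_square)

lemma vnorm_smult: "vnorm (c \<cdot>\<^sub>v x) = \<bar>c\<bar> * vnorm x"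
  by (simp add: vnorm_def real_sqrt_mult)

lemma vnorm_eq_0_iff: "x \<in> carrier_vec n \<Longrightarrow> vnorm x = 0 \<longleftrightarrow> x = 0\<^sub>v n"
  by (auto simp: vnorm_eq_L2_set L2_set_eq_0_iff intro!: eq_vecI)

lemma vnorm_zero [simp]: "vnorm (0\<^sub>v n) = 0"
  by (simp add: vnorm_def)

lemma abs_scalar_prod_le:
  assumes "x \<in> carrier_vec n" "y \<in> carrier_vec n"
  shows "\<bar>x \<bullet> y\<bar> \<le> vnorm x * vnorm y"
proof -
  have "\<bar>x \<bullet> y\<bar> \<le> (\<Sum>i<n. \<bar>x $ i\<bar> * \<bar>y $ i\<bar>)"
    using assms by (auto simp: scalar_prod_sum abs_mult intro: order_trans[OF sum_abs])
  also have "\<dots> \<le> vnorm x * vnorm y"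
    using assms by (simp add: vnorm_eq_L2_set L2_set_mult_ineq)
  finally show ?thesis .
qed

lemma scalar_prod_le:
  assumes "x \<in> carrier_vec n" "y \<in> carrier_vec n"
  shows "x \<bullet> y \<le> vnorm x * vnorm y"
  using abs_scalar_prod_le[OF assms] by linarith

lemma vnorm_square_diff:
  assumes "x \<in> carrier_vec n" "y \<in> carrier_vec n"
  shows "(vnorm (x - y))\<^sup>2 = (vnorm x)\<^sup>2 - 2 * (x \<bullet> y) + (vnorm y)\<^sup>2"
  using assms comm_scalar_prod[of y n x]
  by (simp add: vnorm_square minus_scalar_prod_distrib[of _ n] scalar_prod_minus_distrib[of _ n])

lemma vnorm_square_add:
  assumes "x \<in> carrier_vec n" "y \<in> carrier_vec n"
  shows "(vnorm (x + y))\<^sup>2 = (vnorm x)\<^sup>2 + 2 * (x \<bullet> y) + (vnorm y)\<^sup>2"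
  using assms comm_scalar_prod[of y n x]
  by (simp add: vnorm_square add_scalar_prod_distrib[of _ n] scalar_prod_add_distrib[of _ n])

lemma Loss_unit:
  assumes "u \<in> unit_sphere n" "v \<in> unit_sphere n"
  shows "Loss u v = 2 - 2 * \<bar>u \<bullet> v\<bar>"
  using assms vnorm_square_diff[of u n v] vnorm_square_add[of u n v]
  by (auto simp: Loss_def unit_sphere_def min_def)

section \<open>A singular triple that attains the operator norm\<close>

lemma exists_unit_vector:
  assumes "0 < n"
  shows "\<exists>x. x \<in> unit_sphere n"
  using assms by (intro exI[of _ "unit_vec n 0"]) (auto simp: unit_sphere_def vnorm_def)

lemma scalar_prod_mult_mat_vec_swap:
  fixes A :: "real mat"
  assumes "A \<in> carrier_mat m n" "x \<in> carrier_vec m" "y \<in> carrier_vec n"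
  shows "x \<bullet> (A *\<^sub>v y) = y \<bullet> (transpose_mat A *\<^sub>v x)"
  using assms transpose_vec_mult_scalar[OF assms(1,3,2)]
    comm_scalar_prod[of y n "transpose_mat A *\<^sub>v x"] by simp

text \<open>The equality case of Cauchy-Schwarz: expanding the square of
  \<open>vnorm (y - \<sigma> \<cdot>\<^sub>v x)\<close> leaves
  \<open>(vnorm y)\<^sup>2 - \<sigma>\<^sup>2\<close>, which cannot be positive.\<close>

lemma eq_smultI_vnorm:
  assumes "x \<in> carrier_vec n" "y \<in> carrier_vec n"
    and "vnorm x = 1" "x \<bullet> y = \<sigma>" "vnorm y \<le> \<sigma>"
  shows "y = \<sigma> \<cdot>\<^sub>v x"
proof -
  have "(vnorm (y - \<sigma> \<cdot>\<^sub>v x))\<^sup>2 = (vnorm y)\<^sup>2 - 2 * (\<sigma> * \<sigma>) + \<sigma>\<^sup>2"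
    using assms comm_scalar_prod[of x n y] by (simp add: vnorm_square_diff[of _ n] vnorm_smult)
  also have "(vnorm y)\<^sup>2 \<le> \<sigma>\<^sup>2" using assms by (intro power_mono) auto
  finally have "vnorm (y - \<sigma> \<cdot>\<^sub>v x) = 0" by (simp flip: power2_eq_square)
  then have eq: "y - \<sigma> \<cdot>\<^sub>v x = 0\<^sub>v n" using assms by (subst (asm) vnorm_eq_0_iff[of _ n]) auto
  show ?thesis
  proof (rule eq_vecI)
    fix i assume "i < dim_vec (\<sigma> \<cdot>\<^sub>v x)"
    then show "y $ i = (\<sigma> \<cdot>\<^sub>v x) $ i"
      using assms arg_cong[OF eq, of "\<lambda>z. z $ i"] by auto
  qed (use assms in auto)
qed

text \<open>A continuous function attains its maximum on the compact unit sphere; compactness is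
  proved for a copy of the sphere among functions on the natural numbers, with the product
  topology.\<close>

lemma maximizer_mult_mat_vec:
  fixes A :: "real mat"
  assumes A: "A \<in> carrier_mat m n" and "0 < n"
  shows "\<exists>y\<in>unit_sphere n. \<forall>z\<in>unit_sphere n. vnorm (A *\<^sub>v z) \<le> vnorm (A *\<^sub>v y)"
proof -
  \<comment> \<open>Coordinates from \<open>n\<close> on are pinned to \<open>0\<close>, so that
    \<open>K\<close> is a closed subset of a product of compact sets, compact by Tychonoff.\<close>
  define K :: "(nat \<Rightarrow> real) set" where
    "K = PiE UNIV (\<lambda>i. if i < n then {-1..1} else {0}) \<inter> {f. (\<Sum>i<n. (f i)\<^sup>2) = 1}"
  define F :: "(nat \<Rightarrow> real) \<Rightarrow> real" where "F f = (\<Sum>i<m. (\<Sum>j<n. A $$ (i,j) * f j)\<^sup>2)" for f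
  have F_vec: "F (($) z) = (vnorm (A *\<^sub>v z))\<^sup>2" if "z \<in> carrier_vec n" for z
    using A that
    by (simp add: F_def vnorm_square_sum[of _ m] scalar_prod_sum[of _ n] cong: sum.cong_simp)
  \<comment> \<open>\<open>F\<close> reads only coordinates below \<open>n\<close>; this allows
    passing between a vector, its extension by zeros, and \<open>vec n f\<close>.\<close>
  have F_cong: "F f = F g" if "\<And>i. i < n \<Longrightarrow> f i = g i" for f g
    using that unfolding F_def by (intro sum.cong refl arg_cong2[where f = power]) auto
  have "compactin (product_topology (\<lambda>_. euclidean) UNIV)
      (PiE UNIV (\<lambda>i. if i < n then {-1..1} else {0 :: real}))"
    unfolding compactin_PiE by simp
  then have "compact (PiE UNIV (\<lambda>i. if i < n then {-1..1} else {0 :: real}))"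
    by (simp add: euclidean_product_topology)
  moreover have "closed {f :: nat \<Rightarrow> real. (\<Sum>i<n. (f i)\<^sup>2) = 1}"
    by (intro closed_Collect_eq continuous_intros continuous_on_product_coordinates)
  ultimately have "compact K" unfolding K_def by (rule compact_Int_closed)
  moreover have in_K: "(\<lambda>i. if i < n then z $ i else 0) \<in> K" if z: "z \<in> unit_sphere n" for z
  proof -
    have 1: "(\<Sum>i<n. (z $ i)\<^sup>2) = 1"
      using z by (auto simp: unit_sphere_def simp flip: vnorm_square_sum)
    have "\<bar>z $ i\<bar> \<le> 1" if "i < n" for i
      using member_le_sum[of i "{..<n}" "\<lambda>i. (z $ i)\<^sup>2"] that 1 by (simp add: abs_square_le_1)
    then have "z $ i \<in> {-1..1}" if "i < n" for i using that by (simp add: abs_le_iff minus_le_iff)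
    then show ?thesis using 1 by (auto simp: K_def)
  qed
  then have "K \<noteq> {}" using exists_unit_vector[OF \<open>0 < n\<close>] by blast
  moreover have "continuous_on K F" unfolding F_def
    by (intro continuous_intros continuous_on_subset[OF continuous_on_product_coordinates]) auto
  ultimately obtain f where f: "f \<in> K" "\<And>g. g \<in> K \<Longrightarrow> F g \<le> F f"
    using continuous_attains_sup by metis
  show ?thesis
  proof (intro bexI ballI)
    fix z assume z: "z \<in> unit_sphere n"
    have "(vnorm (A *\<^sub>v z))\<^sup>2 = F (($) z)"
      using z by (simp add: F_vec unit_sphere_def)
    also have "\<dots> = F (\<lambda>i. if i < n then z $ i else 0)" by (rule F_cong) simp
    also have "\<dots> \<le> F f" by (intro f in_K z)
    also have "\<dots> = F (($) (vec n f))" by (rule F_cong) simp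
    also have "\<dots> = (vnorm (A *\<^sub>v vec n f))\<^sup>2" by (simp add: F_vec)
    finally show "vnorm (A *\<^sub>v z) \<le> vnorm (A *\<^sub>v vec n f)" by (rule power2_le_imp_le) simp
  next
    have "vec n f \<bullet> vec n f = 1" using f(1) by (simp add: K_def vnorm_square_sum flip: vnorm_square)
    then show "vec n f \<in> unit_sphere n" by (simp add: unit_sphere_def vnorm_def)
  qed
qed

lemma vnorm_mult_mat_vec_bound:
  fixes A :: "real mat"
  assumes A: "A \<in> carrier_mat m n" and z: "z \<in> carrier_vec n"
    and bound: "\<And>z. z \<in> unit_sphere n \<Longrightarrow> vnorm (A *\<^sub>v z) \<le> \<sigma>"
  shows "vnorm (A *\<^sub>v z) \<le> \<sigma> * vnorm z"
proof (cases "vnorm z = 0")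
  case True
  then have "z = 0\<^sub>v n" using vnorm_eq_0_iff z by blast
  moreover have "A *\<^sub>v 0\<^sub>v n = 0\<^sub>v m" using A by (intro eq_vecI) auto
  ultimately show ?thesis by simp
next
  case False
  then have pos: "0 < vnorm z" by (simp add: order_less_le)
  define z' where "z' = (1 / vnorm z) \<cdot>\<^sub>v z"
  have "z' \<in> unit_sphere n" using z pos by (simp add: z'_def unit_sphere_def vnorm_smult)
  then have "vnorm (A *\<^sub>v z') \<le> \<sigma>" by (rule bound)
  also have "A *\<^sub>v z' = (1 / vnorm z) \<cdot>\<^sub>v (A *\<^sub>v z)" using A z by (simp add: z'_def mult_mat_vec)
  finally show ?thesis using pos by (simp add: vnorm_smult field_simps)
qed

text \<open>Take \<open>y\<close> maximizing \<open>vnorm (A *\<^sub>v y)\<close> on the sphere,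
  \<open>\<sigma>\<close> the maximum and \<open>x\<close> the normalized image. Then the transpose
  sends \<open>x\<close> to a vector of norm at most \<open>\<sigma>\<close> whose inner product
  with \<open>y\<close> is \<open>\<sigma>\<close>, which forces it to be
  \<open>\<sigma> \<cdot>\<^sub>v y\<close>.\<close>

lemma exists_maximal_singular_triple:
  fixes A :: "real mat"
  assumes A: "A \<in> carrier_mat m n" and "0 < m" "0 < n"
  shows "\<exists>\<sigma> x y. singular_triple A \<sigma> x y \<and> (\<forall>z\<in>carrier_vec n. vnorm (A *\<^sub>v z) \<le> \<sigma> * vnorm z)"
proof -
  obtain y where y: "y \<in> unit_sphere n"
    and max: "\<And>z. z \<in> unit_sphere n \<Longrightarrow> vnorm (A *\<^sub>v z) \<le> vnorm (A *\<^sub>v y)"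
    using maximizer_mult_mat_vec[OF A \<open>0 < n\<close>] by blast
  have yc: "y \<in> carrier_vec n" and y1: "vnorm y = 1" using y by (auto simp: unit_sphere_def)
  define \<sigma> where "\<sigma> = vnorm (A *\<^sub>v y)"
  have \<sigma>: "0 \<le> \<sigma>" by (simp add: \<sigma>_def)
  have bound: "vnorm (A *\<^sub>v z) \<le> \<sigma> * vnorm z" if "z \<in> carrier_vec n" for z
    using vnorm_mult_mat_vec_bound[OF A that] max unfolding \<sigma>_def by blast
  obtain x where x: "x \<in> unit_sphere m" and Ay: "A *\<^sub>v y = \<sigma> \<cdot>\<^sub>v x"
  proof (cases "\<sigma> = 0")
    \<comment> \<open>The image of \<open>y\<close> vanishes and cannot be normalized; any unit
      vector serves as \<open>x\<close>.\<close>
    case True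
    then have "A *\<^sub>v y = 0\<^sub>v m"
      using A yc vnorm_eq_0_iff[of "A *\<^sub>v y" m] by (simp add: \<sigma>_def)
    then have "A *\<^sub>v y = \<sigma> \<cdot>\<^sub>v x" if "x \<in> unit_sphere m" for x
      using that True by (auto simp: unit_sphere_def)
    then show ?thesis using that exists_unit_vector[OF \<open>0 < m\<close>] by blast
  next
    case False
    show ?thesis
    proof (rule that[of "(1 / \<sigma>) \<cdot>\<^sub>v (A *\<^sub>v y)"])
      show "(1 / \<sigma>) \<cdot>\<^sub>v (A *\<^sub>v y) \<in> unit_sphere m"
        using False \<sigma> A yc by (auto simp: unit_sphere_def vnorm_smult simp flip: \<sigma>_def)
      show "A *\<^sub>v y = \<sigma> \<cdot>\<^sub>v ((1 / \<sigma>) \<cdot>\<^sub>v (A *\<^sub>v y))"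
        using False by (simp add: smult_smult_assoc)
    qed
  qed
  have xc: "x \<in> carrier_vec m" and x1: "vnorm x = 1" using x by (auto simp: unit_sphere_def)
  let ?z = "transpose_mat A *\<^sub>v x"
  have zc: "?z \<in> carrier_vec n" using A xc by simp
  have "y \<bullet> ?z = \<sigma>"
    using scalar_prod_mult_mat_vec_swap[OF A xc yc] xc x1
    by (simp add: Ay flip: vnorm_square)
  \<comment> \<open>The square of this norm is \<open>x \<bullet> (A *\<^sub>v ?z)\<close>, at most
    \<open>\<sigma> * vnorm ?z\<close>; one factor cancels.\<close>
  moreover have "vnorm ?z \<le> \<sigma>"
  proof -
    have "(vnorm ?z)\<^sup>2 = x \<bullet> (A *\<^sub>v ?z)"
      using scalar_prod_mult_mat_vec_swap[OF A xc zc] by (simp add: vnorm_square)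
    also have "\<dots> \<le> \<sigma> * vnorm ?z"
      using scalar_prod_le[OF xc, of "A *\<^sub>v ?z"] bound[OF zc] A zc by (simp add: x1)
    finally show ?thesis using \<sigma> by (cases "vnorm ?z = 0") (auto simp: power2_eq_square order_less_le)
  qed
  ultimately have "?z = \<sigma> \<cdot>\<^sub>v y" by (intro eq_smultI_vnorm[OF yc zc y1])
  then have "singular_triple A \<sigma> x y"
    using \<sigma> x y Ay A by (auto simp: singular_triple_def)
  then show ?thesis using bound by blast
qed

section \<open>The top singular vector of a rank-one matrix plus a perturbation\<close>

text \<open>The definition compares \<open>\<sigma>\<close> only with other singular values. One of
  these is the operator norm, so \<open>\<sigma>\<close> dominates the bilinear form on all pairs of
  unit vectors.\<close>

lemma top_right_singular_vectorE:
  fixes A :: "real mat"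
  assumes A: "A \<in> carrier_mat m n" and "0 < m" "0 < n" and "top_right_singular_vector A w"
  obtains \<sigma> u where "singular_triple A \<sigma> u w"
    "\<And>x y. x \<in> unit_sphere m \<Longrightarrow> y \<in> unit_sphere n \<Longrightarrow> x \<bullet> (A *\<^sub>v y) \<le> \<sigma>"
proof -
  obtain \<sigma> u where tr: "singular_triple A \<sigma> u w"
    and top: "\<And>\<sigma>' u' w'. singular_triple A \<sigma>' u' w' \<Longrightarrow> \<sigma>' \<le> \<sigma>"
    using assms(4) unfolding top_right_singular_vector_def by blast
  obtain \<sigma>' x' y' where s': "singular_triple A \<sigma>' x' y'"
    and b: "\<And>z. z \<in> carrier_vec n \<Longrightarrow> vnorm (A *\<^sub>v z) \<le> \<sigma>' * vnorm z"
    using exists_maximal_singular_triple[OF assms(1-3)] by blast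
  have "x \<bullet> (A *\<^sub>v y) \<le> \<sigma>" if "x \<in> unit_sphere m" "y \<in> unit_sphere n" for x y
    using scalar_prod_le[of x m "A *\<^sub>v y"] b[of y] top[OF s'] A that
    by (auto simp: unit_sphere_def)
  then show ?thesis using that tr by blast
qed

text \<open>On the component \<open>r\<close> of \<open>w\<close> orthogonal to \<open>v\<close> the spike vanishes, hence
  \<open>\<sigma> \<parallel>r\<parallel> \<le> \<epsilon>\<close>; when \<open>\<beta> < 2 \<epsilon>\<close> the bound exceeds the trivial value \<open>2\<close> of the loss.\<close>

lemma Loss_top_right_singular_vector_le:
  fixes A :: "real mat"
  assumes A: "A \<in> carrier_mat m n" and "0 < m" "0 < n" and top: "top_right_singular_vector A w"
    and u: "u \<in> unit_sphere m" and v: "v \<in> unit_sphere n" and "0 < \<beta>" "0 \<le> \<epsilon>"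
    and pert: "\<And>x y. x \<in> carrier_vec m \<Longrightarrow> y \<in> carrier_vec n \<Longrightarrow>
      \<bar>x \<bullet> (A *\<^sub>v y) - \<beta> * (x \<bullet> u) * (v \<bullet> y)\<bar> \<le> \<epsilon> * vnorm x * vnorm y"
  shows "Loss w v \<le> 8 * \<epsilon>\<^sup>2 / \<beta>\<^sup>2"
proof -
  obtain \<sigma> u' where tr: "singular_triple A \<sigma> u' w"
    and max: "\<And>x y. x \<in> unit_sphere m \<Longrightarrow> y \<in> unit_sphere n \<Longrightarrow> x \<bullet> (A *\<^sub>v y) \<le> \<sigma>"
    using top_right_singular_vectorE[OF A assms(2,3) top] by metis
  have w: "w \<in> unit_sphere n" and u': "u' \<in> unit_sphere m"
    and Atu': "transpose_mat A *\<^sub>v u' = \<sigma> \<cdot>\<^sub>v w"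
    using tr A by (auto simp: singular_triple_def)
  have c: "w \<in> carrier_vec n" "v \<in> carrier_vec n" "u' \<in> carrier_vec m" "u \<in> carrier_vec m"
    and 1: "vnorm w = 1" "vnorm v = 1" "vnorm u' = 1" "vnorm u = 1"
    using w u' u v by (auto simp: unit_sphere_def)
  define c where "c = w \<bullet> v"
  have Loss: "Loss w v = 2 - 2 * \<bar>c\<bar>" by (simp add: Loss_unit[OF w v] c_def)
  show ?thesis
  proof (cases "2 * \<epsilon> \<le> \<beta>")
    case False
    then have "\<beta>\<^sup>2 \<le> (2 * \<epsilon>)\<^sup>2" using \<open>0 < \<beta>\<close> by (intro power_mono) auto
    then have "2 \<le> 8 * \<epsilon>\<^sup>2 / \<beta>\<^sup>2" using \<open>0 < \<beta>\<close> by (simp add: field_simps)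
    then show ?thesis using Loss by linarith
  next
    case True
    define r where "r = w - c \<cdot>\<^sub>v v"
    have rc: "r \<in> carrier_vec n" using c by (simp add: r_def)
    have vv: "v \<bullet> v = 1" "w \<bullet> w = 1" "u \<bullet> u = 1" using 1 by (simp_all flip: vnorm_square)
    have rv: "v \<bullet> r = 0" using c comm_scalar_prod[of v n w]
      by (simp add: r_def scalar_prod_minus_distrib[of _ n] vv c_def)
    have rw: "r \<bullet> w = 1 - c\<^sup>2" using c comm_scalar_prod[of v n w]
      by (simp add: r_def minus_scalar_prod_distrib[of _ n] vv c_def power2_eq_square)
    have nr: "(vnorm r)\<^sup>2 = 1 - c\<^sup>2"
      using c 1 by (simp add: r_def vnorm_square_diff[of _ n] vnorm_smult power_mult_distrib)
        (simp add: c_def power2_eq_square)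
    \<comment> \<open>Testing the maximality of \<open>\<sigma>\<close> on the spike directions
      bounds it below by \<open>\<beta> - \<epsilon>\<close>, hence by \<open>\<beta> / 2\<close> in
      this case.\<close>
    have "\<beta> - \<epsilon> \<le> u \<bullet> (A *\<^sub>v v)"
      using pert[of u v] c by (simp add: vv 1)
    also have "\<dots> \<le> \<sigma>" by (intro max u v)
    finally have \<sigma>: "\<beta> / 2 \<le> \<sigma>" using True by linarith
    \<comment> \<open>Pairing \<open>r\<close> with the singular equation for \<open>u'\<close>:
      since \<open>r \<bullet> w\<close> equals the squared norm of \<open>r\<close> and
      \<open>v \<bullet> r = 0\<close>, only the perturbation remains on the right.\<close>
    have "\<sigma> * (vnorm r)\<^sup>2 = r \<bullet> (\<sigma> \<cdot>\<^sub>v w)" using rc c by (simp add: nr rw)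
    also have "\<dots> = u' \<bullet> (A *\<^sub>v r)"
      using scalar_prod_mult_mat_vec_swap[OF A c(3) rc] by (simp add: Atu')
    also have "\<dots> \<le> \<epsilon> * vnorm r" using pert[OF c(3) rc] by (simp add: rv 1)
    finally have "\<sigma> * vnorm r \<le> \<epsilon>"
      using \<open>0 \<le> \<epsilon>\<close> by (cases "vnorm r = 0") (auto simp: power2_eq_square order_less_le)
    then have "\<beta> * vnorm r \<le> 2 * \<epsilon>" using mult_right_mono[OF \<sigma>, of "vnorm r"] by simp
    then have "(\<beta> * vnorm r)\<^sup>2 \<le> (2 * \<epsilon>)\<^sup>2" using \<open>0 < \<beta>\<close> by (intro power_mono) auto
    then have "1 - c\<^sup>2 \<le> 4 * \<epsilon>\<^sup>2 / \<beta>\<^sup>2"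
      using \<open>0 < \<beta>\<close> by (simp add: power_mult_distrib field_simps nr)
    \<comment> \<open>This turns the bound on \<open>1 - c\<^sup>2\<close> into one on
      \<open>1 - \<bar>c\<bar>\<close>, half the loss; doubling \<open>4\<close> gives the constant
      \<open>8\<close>.\<close>
    moreover have "c\<^sup>2 \<le> \<bar>c\<bar>"
    proof -
      have "\<bar>c\<bar> \<le> 1" using abs_scalar_prod_le[of w n v] c 1 by (simp add: c_def)
      then show ?thesis using mult_left_mono[of "\<bar>c\<bar>" 1 "\<bar>c\<bar>"] by (simp add: power2_eq_square)
    qed
    ultimately show ?thesis using Loss by simp
  qed
qed


section \<open>Grid nets of the unit ball\<close>

text \<open>Integer points of the ball of radius \<open>4 * sqrt n\<close>. With mesh
  \<open>1 / (4 * sqrt n)\<close> they scale into the unit ball, and an error of one mesh width in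
  each of \<open>n\<close> coordinates has norm \<open>1 / 4\<close>.\<close>

definition grid_points :: "nat \<Rightarrow> (nat \<Rightarrow> int) set" where
  "grid_points n = {m \<in> {..<n} \<rightarrow>\<^sub>E UNIV. (\<Sum>i<n. (m i)\<^sup>2) \<le> 16 * int n}"

definition grid_net :: "nat \<Rightarrow> real vec set" where
  "grid_net n = (\<lambda>m. vec n (\<lambda>i. of_int (m i) / (4 * sqrt (real n)))) ` grid_points n"

lemma sum_half_power_abs:
  "(\<Sum>j\<in>{- int r..int r}. (1 / 2 :: real) ^ nat \<bar>j\<bar>) = 3 - 2 * (1 / 2) ^ r"
proof (induction r)
  case (Suc r)
  have "{- int (Suc r)..int (Suc r)} = insert (- int (Suc r)) (insert (int (Suc r)) {- int r..int r})"
    by auto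
  then show ?case using Suc by (simp add: nat_add_distrib)
qed simp

lemma abs_le_square_int: "\<bar>j\<bar> \<le> (j :: int)\<^sup>2"
  using self_le_power[of "\<bar>j\<bar>" 2] by (cases "j = 0") auto

text \<open>Counting with the weights \<open>2\<^sup>1\<^sup>6\<^sup>n 2\<^bsup>-|m\<^sub>1| - \<dots> - |m\<^sub>n|\<^esup>\<close>, which are at least \<open>1\<close> on grid points and
  factor over the coordinates.\<close>

lemma finite_card_grid_points:
  "finite (grid_points n) \<and> card (grid_points n) \<le> 2 ^ (18 * n)"
proof -
  \<comment> \<open>A finite box containing the grid points, over which the sum of the product
    weights becomes a product of sums.\<close>
  define B :: "(nat \<Rightarrow> int) set" where "B = {..<n} \<rightarrow>\<^sub>E {- int (16 * n)..int (16 * n)}"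
  define wt :: "(nat \<Rightarrow> int) \<Rightarrow> real" where "wt m = (\<Prod>i<n. 2 ^ 16 * (1 / 2) ^ nat \<bar>m i\<bar>)" for m
  \<comment> \<open>For integers \<open>\<bar>j\<bar> \<le> j\<^sup>2\<close>, so the sum of
    absolute values inherits the bound \<open>16 * n\<close>; this is the exponent \<open>16\<close>
    in the weight.\<close>
  have le: "(\<Sum>i<n. nat \<bar>m i\<bar>) \<le> 16 * n" if "m \<in> grid_points n" for m
  proof -
    have "int (\<Sum>i<n. nat \<bar>m i\<bar>) \<le> (\<Sum>i<n. (m i)\<^sup>2)"
      by (auto simp: abs_le_square_int intro!: sum_mono)
    also have "\<dots> \<le> int (16 * n)" using that by (simp add: grid_points_def)
    finally show ?thesis by (simp only: of_nat_le_iff)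
  qed
  have sub: "grid_points n \<subseteq> B"
  proof
    fix m assume m: "m \<in> grid_points n"
    have "nat \<bar>m i\<bar> \<le> 16 * n" if "i < n" for i
      using member_le_sum[of i "{..<n}" "\<lambda>i. nat \<bar>m i\<bar>"] le[OF m] that by simp
    then have "\<bar>m i\<bar> \<le> 16 * int n" if "i < n" for i using that by (force simp: nat_le_iff)
    then show "m \<in> B" using m unfolding B_def grid_points_def
      by (auto simp: PiE_iff abs_le_iff) (smt (verit))
  qed
  have "finite B" unfolding B_def by (intro finite_PiE) auto
  then have fin: "finite (grid_points n)" using sub finite_subset by blast
  have wt: "1 \<le> wt m" if "m \<in> grid_points n" for m
  proof -
    have "wt m = 2 ^ (16 * n) * (1 / 2) ^ (\<Sum>i<n. nat \<bar>m i\<bar>)"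
      by (simp add: wt_def prod.distrib power_sum power_mult)
    also have "\<dots> \<ge> 2 ^ (16 * n) * (1 / 2) ^ (16 * n)"
      using le[OF that] by (intro mult_left_mono power_decreasing) auto
    finally show ?thesis by (simp add: power_one_over)
  qed
  have "real (card (grid_points n)) = (\<Sum>m\<in>grid_points n. 1)" by simp
  also have "\<dots> \<le> (\<Sum>m\<in>grid_points n. wt m)" by (intro sum_mono wt)
  also have "\<dots> \<le> (\<Sum>m\<in>B. wt m)"
    using sub \<open>finite B\<close> by (intro sum_mono2) (auto simp: wt_def intro!: prod_nonneg)
  also have "\<dots> = (\<Prod>i<n. \<Sum>j\<in>{- int (16 * n)..int (16 * n)}. 2 ^ 16 * (1 / 2) ^ nat \<bar>j\<bar>)"
    unfolding wt_def B_def by (subst prod_sum_PiE) auto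
  also have "\<dots> = (2 ^ 16 * (3 - 2 * (1 / 2) ^ (16 * n))) ^ n"
    by (simp only: sum_half_power_abs prod_constant card_lessThan flip: sum_distrib_left)
  \<comment> \<open>Each coordinate contributes less than \<open>3 * 2 ^ 16\<close>, rounded up to a
    power of two.\<close>
  also have "\<dots> \<le> (2 ^ 18) ^ n"
  proof (rule power_mono)
    define c :: real where "c = (1 / 2) ^ (16 * n)"
    have "0 \<le> c" "c \<le> 1" by (auto simp: c_def intro: power_le_one)
    then show "2 ^ 16 * (3 - 2 * (1 / 2) ^ (16 * n)) \<le> (2 ^ 18 :: real)"
      "0 \<le> 2 ^ 16 * (3 - 2 * (1 / 2 :: real) ^ (16 * n))"
      unfolding c_def[symmetric] by simp_all
  qed
  also have "\<dots> = real (2 ^ (18 * n))" by (simp only: power_mult of_nat_power of_nat_numeral)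
  finally show ?thesis using fin by linarith
qed

lemma finite_grid_net: "finite (grid_net n)"
  using finite_card_grid_points by (simp add: grid_net_def)

lemma card_grid_net: "card (grid_net n) \<le> 2 ^ (18 * n)"
  using card_image_le[of "grid_points n"] finite_card_grid_points
  unfolding grid_net_def by (meson le_trans)

lemma grid_net_carrier: "x \<in> grid_net n \<Longrightarrow> x \<in> carrier_vec n"
  by (auto simp: grid_net_def)

lemma vnorm_grid_net:
  assumes "x \<in> grid_net n"
  shows "vnorm x \<le> 1"
proof (cases "n = 0")
  case True
  then show ?thesis using grid_net_carrier[OF assms] by (simp add: vnorm_eq_L2_set)
next
  case False
  obtain m where m: "m \<in> grid_points n" and x: "x = vec n (\<lambda>i. of_int (m i) / (4 * sqrt (real n)))"
    using assms by (auto simp: grid_net_def)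
  have "real_of_int (\<Sum>i<n. (m i)\<^sup>2) \<le> real_of_int (16 * int n)"
    using m by (simp only: of_int_le_iff) (simp add: grid_points_def)
  then have "(\<Sum>i<n. (of_int (m i))\<^sup>2) / (16 * real n) \<le> 1"
    using False by (simp add: divide_le_eq)
  then have "(vnorm x)\<^sup>2 \<le> 1"
    by (simp add: x vnorm_square_sum[of _ n] power_divide power_mult_distrib sum_divide_distrib)
  then show ?thesis by (simp add: abs_square_le_1)
qed

text \<open>Scale by \<open>s = 4 * sqrt n\<close> and round every coordinate towards
  \<open>0\<close>. Absolute values do not grow, so the rounded point stays in the ball; each
  coordinate moves by at most \<open>1\<close>, so the squared error is at most
  \<open>n / s\<^sup>2 = 1 / 16\<close>.\<close>

lemma exists_near_grid_net:
  assumes x: "x \<in> carrier_vec n" "vnorm x \<le> 1" and "0 < n"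
  shows "\<exists>y\<in>grid_net n. vnorm (x - y) \<le> 1 / 4"
proof -
  define s where "s = 4 * sqrt (real n)"
  have s: "0 < s" "s\<^sup>2 = 16 * real n" using \<open>0 < n\<close> by (simp_all add: s_def power_mult_distrib)
  define m where "m = (\<lambda>i\<in>{..<n}. if 0 \<le> x $ i then \<lfloor>s * x $ i\<rfloor> else \<lceil>s * x $ i\<rceil>)"
  have m1: "\<bar>real_of_int (m i)\<bar> \<le> \<bar>s * x $ i\<bar>" if "i < n" for i
  proof (cases "0 \<le> x $ i")
    case True
    then have "0 \<le> s * x $ i" using s by simp
    then show ?thesis using that True by (simp add: m_def)
  next
    case False
    then have "s * x $ i \<le> 0" using s by (simp add: mult_le_0_iff)
    then have "real_of_int \<lceil>s * x $ i\<rceil> \<le> 0" by simp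
    then show ?thesis using that False le_of_int_ceiling[of "s * x $ i"] \<open>s * x $ i \<le> 0\<close>
      by (simp add: m_def del: of_int_le_0_iff ceiling_le_zero)
  qed
  have m2: "\<bar>s * x $ i - real_of_int (m i)\<bar> \<le> 1" if "i < n" for i
    using that unfolding m_def by (simp add: abs_le_iff) linarith
  have "real_of_int (\<Sum>i<n. (m i)\<^sup>2) \<le> (\<Sum>i<n. (s * x $ i)\<^sup>2)"
    using m1 by (auto intro!: sum_mono simp: abs_le_square_iff)
  also have "\<dots> = s\<^sup>2 * (vnorm x)\<^sup>2"
    using x by (simp add: vnorm_square_sum[of _ n] power_mult_distrib sum_distrib_left)
  also have "\<dots> \<le> s\<^sup>2 * 1"
    using x by (intro mult_left_mono) (auto simp: abs_square_le_1)
  finally have "real_of_int (\<Sum>i<n. (m i)\<^sup>2) \<le> real_of_int (16 * int n)" using s by simp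
  then have m: "m \<in> grid_points n"
    by (simp only: of_int_le_iff) (auto simp: grid_points_def m_def)
  define y where "y = vec n (\<lambda>i. of_int (m i) / s)"
  have "y \<in> grid_net n" using m by (auto simp: grid_net_def y_def s_def)
  moreover have "(vnorm (x - y))\<^sup>2 \<le> (1 / 4)\<^sup>2"
  proof -
    have "(vnorm (x - y))\<^sup>2 = (\<Sum>i<n. (x $ i - of_int (m i) / s)\<^sup>2)"
      using x by (simp add: vnorm_square_sum[of _ n] y_def)
    also have "\<dots> \<le> (\<Sum>i<n. 1 / s\<^sup>2)"
    proof (rule sum_mono)
      fix i assume "i \<in> {..<n}"
      then have "\<bar>s * x $ i - of_int (m i)\<bar>\<^sup>2 \<le> 1" using m2 by (simp add: abs_square_le_1)
      moreover have "x $ i - of_int (m i) / s = (s * x $ i - of_int (m i)) / s"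
        using s by (simp add: field_simps)
      ultimately show "(x $ i - of_int (m i) / s)\<^sup>2 \<le> 1 / s\<^sup>2"
        by (simp add: power_divide divide_right_mono)
    qed
    also have "\<dots> = (1 / 4)\<^sup>2" using \<open>0 < n\<close> by (simp add: s power_divide)
    finally show ?thesis .
  qed
  then have "vnorm (x - y) \<le> 1 / 4" by (rule power2_le_imp_le) simp
  ultimately show ?thesis by blast
qed

text \<open>Moving the maximal singular pair to nearby net points costs at most
  \<open>\<sigma> / 4\<close> per side, so \<open>\<sigma> \<le> t + \<sigma> / 2\<close>. The
  one-sided bound on the net controls absolute values because the operator norm
  \<open>\<sigma>\<close> is itself the value \<open>p \<bullet> (A *\<^sub>v q)\<close>.\<close>

lemma bilinear_bound_from_grid_net:
  fixes A :: "real mat"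
  assumes A: "A \<in> carrier_mat m n" and "0 < m" "0 < n"
    and net: "\<And>x y. x \<in> grid_net m \<Longrightarrow> y \<in> grid_net n \<Longrightarrow> x \<bullet> (A *\<^sub>v y) \<le> t"
    and x: "x \<in> carrier_vec m" and y: "y \<in> carrier_vec n"
  shows "\<bar>x \<bullet> (A *\<^sub>v y)\<bar> \<le> 2 * t * vnorm x * vnorm y"
proof -
  obtain \<sigma> p q where tr: "singular_triple A \<sigma> p q"
    and bd: "\<And>z. z \<in> carrier_vec n \<Longrightarrow> vnorm (A *\<^sub>v z) \<le> \<sigma> * vnorm z"
    using exists_maximal_singular_triple[OF assms(1-3)] by blast
  have pq: "p \<in> carrier_vec m" "q \<in> carrier_vec n" "vnorm p = 1" "vnorm q = 1"
    and Aq: "A *\<^sub>v q = \<sigma> \<cdot>\<^sub>v p" and "0 \<le> \<sigma>"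
    using tr A by (auto simp: singular_triple_def unit_sphere_def)
  obtain p' where p': "p' \<in> grid_net m" "vnorm (p - p') \<le> 1 / 4"
    using exists_near_grid_net[of p m] pq \<open>0 < m\<close> by auto
  obtain q' where q': "q' \<in> grid_net n" "vnorm (q - q') \<le> 1 / 4"
    using exists_near_grid_net[of q n] pq \<open>0 < n\<close> by auto
  have c: "p' \<in> carrier_vec m" "q' \<in> carrier_vec n" using p' q' grid_net_carrier by auto
  have Aqc: "A *\<^sub>v q \<in> carrier_vec m" "A *\<^sub>v q' \<in> carrier_vec m" using A pq c by auto
  \<comment> \<open>The value at \<open>(p, q)\<close> is split as the value at
    \<open>(p', q')\<close> plus those at \<open>(p', q - q')\<close> and
    \<open>(p - p', q)\<close>.\<close>
  have "A *\<^sub>v (q - q') = A *\<^sub>v q - A *\<^sub>v q'"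
    using A pq c by (intro mult_minus_distrib_mat_vec)
  then have "p' \<bullet> (A *\<^sub>v (q - q')) = p' \<bullet> (A *\<^sub>v q) - p' \<bullet> (A *\<^sub>v q')"
    using Aqc c by (simp add: scalar_prod_minus_distrib[of _ m])
  moreover have "(p - p') \<bullet> (A *\<^sub>v q) = p \<bullet> (A *\<^sub>v q) - p' \<bullet> (A *\<^sub>v q)"
    using Aqc c pq by (simp add: minus_scalar_prod_distrib[of _ m])
  moreover have "p \<bullet> (A *\<^sub>v q) = \<sigma>"
    using pq by (simp add: Aq flip: vnorm_square)
  moreover have "(p - p') \<bullet> (A *\<^sub>v q) \<le> 1 / 4 * \<sigma>"
  proof -
    have "(p - p') \<bullet> (A *\<^sub>v q) \<le> vnorm (p - p') * vnorm (A *\<^sub>v q)"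
      using pq c Aqc by (intro scalar_prod_le) auto
    also have "\<dots> \<le> 1 / 4 * \<sigma>"
      using bd[OF pq(2)] p'(2) pq by (intro mult_mono) auto
    finally show ?thesis .
  qed
  moreover have "p' \<bullet> (A *\<^sub>v (q - q')) \<le> 1 * (\<sigma> * (1 / 4))"
  proof -
    have "p' \<bullet> (A *\<^sub>v (q - q')) \<le> vnorm p' * vnorm (A *\<^sub>v (q - q'))"
      using A pq c by (intro scalar_prod_le) auto
    also have "vnorm (A *\<^sub>v (q - q')) \<le> \<sigma> * vnorm (q - q')" using pq c by (intro bd) auto
    also have "vnorm p' * (\<sigma> * vnorm (q - q')) \<le> 1 * (\<sigma> * (1 / 4))"
      using vnorm_grid_net[OF p'(1)] q'(2) \<open>0 \<le> \<sigma>\<close> by (intro mult_mono) auto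
    finally show ?thesis by (simp add: mult_left_mono)
  qed
  moreover have "p' \<bullet> (A *\<^sub>v q') \<le> t" by (intro net p' q')
  ultimately have \<sigma>: "\<sigma> \<le> 2 * t" by linarith
  have "\<bar>x \<bullet> (A *\<^sub>v y)\<bar> \<le> vnorm x * vnorm (A *\<^sub>v y)"
    using A x y by (intro abs_scalar_prod_le) auto
  also have "\<dots> \<le> vnorm x * (\<sigma> * vnorm y)" by (intro mult_left_mono bd y) auto
  also have "\<dots> \<le> vnorm x * (2 * t * vnorm y)"
    using \<sigma> by (intro mult_left_mono mult_right_mono) auto
  finally show ?thesis by (simp add: mult_ac)
qed


section \<open>Gaussian linear forms\<close>

text \<open>Completing the square: tilting the density by \<open>exp (a * x)\<close> gives
  \<open>exp (a\<^sup>2 / 2)\<close> times the normal density with mean \<open>a\<close>.\<close>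

lemma std_normal_exp_moment:
  "(\<integral>\<^sup>+x. ennreal (exp (a * x)) \<partial>std_normal_distribution) = ennreal (exp (a\<^sup>2 / 2))"
proof -
  have eq: "std_normal_density x * exp (a * x) = exp (a\<^sup>2 / 2) * normal_density a 1 x" for x
    by (simp add: normal_density_def flip: exp_add) (simp add: power2_eq_square field_simps)
  have "(\<integral>\<^sup>+x. ennreal (exp (a * x)) \<partial>std_normal_distribution)
      = (\<integral>\<^sup>+x. ennreal (exp (a\<^sup>2 / 2)) * ennreal (normal_density a 1 x) \<partial>lborel)"
    by (subst nn_integral_density) (auto simp: eq simp flip: ennreal_mult)
  also have "\<dots> = ennreal (exp (a\<^sup>2 / 2)) * emeasure (density lborel (normal_density a 1)) UNIV"
    by (subst nn_integral_cmult) (auto simp: emeasure_density)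
  also have "emeasure (density lborel (normal_density a 1)) UNIV = 1"
    using prob_space.emeasure_space_1[OF prob_space_normal_density[of 1 a]] by simp
  finally show ?thesis by simp
qed

text \<open>Chernoff bound; the exponential moment factors over the independent coordinates. Only an
  upper bound \<open>V\<close> on the variance is assumed, since the coefficients arising later are
  controlled only through such a bound.\<close>

lemma gaussian_linear_form_tail:
  fixes c :: "'i \<Rightarrow> real"
  assumes "finite I" "0 < t" "0 < V" "(\<Sum>i\<in>I. (c i)\<^sup>2) \<le> V"
  defines "N \<equiv> Pi\<^sub>M I (\<lambda>_. std_normal_distribution)"
  shows "measure N {G \<in> space N. t \<le> (\<Sum>i\<in>I. c i * G i)} \<le> exp (- t\<^sup>2 / (2 * V))"
proof -
  interpret S: prob_space std_normal_distribution by (rule prob_space_normal_density) simp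
  interpret P: product_prob_space "\<lambda>_. std_normal_distribution" I ..
  interpret N: prob_space N unfolding N_def by (rule prob_space_PiM) unfold_locales
  \<comment> \<open>The minimizer of the exponent
    \<open>- s * t + s\<^sup>2 * V / 2\<close>.\<close>
  define s where "s = t / V"
  have "0 < s" using assms by (simp add: s_def)
  have meas: "(\<lambda>G. \<Sum>i\<in>I. c i * G i) \<in> borel_measurable N"
    unfolding N_def by measurable
  have "emeasure N {G \<in> space N. t \<le> (\<Sum>i\<in>I. c i * G i)}
      \<le> ennreal (exp (- s * t)) *
        (\<integral>\<^sup>+G. ennreal (exp (s * (\<Sum>i\<in>I. c i * G i))) * indicator (space N) G \<partial>N)"
    using \<open>0 < s\<close> meas by (intro Chernoff_ineq_nn_integral_ge) auto
  also have "(\<integral>\<^sup>+G. ennreal (exp (s * (\<Sum>i\<in>I. c i * G i))) * indicator (space N) G \<partial>N)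
      = (\<integral>\<^sup>+G. (\<Prod>i\<in>I. ennreal (exp (s * c i * G i))) \<partial>N)"
    using \<open>finite I\<close> by (intro nn_integral_cong)
      (simp add: sum_distrib_left exp_sum prod_ennreal mult.assoc)
  also have "\<dots> = (\<Prod>i\<in>I. \<integral>\<^sup>+x. ennreal (exp (s * c i * x)) \<partial>std_normal_distribution)"
    unfolding N_def using \<open>finite I\<close> by (intro P.product_nn_integral_prod) auto
  also have "\<dots> = ennreal (exp (s\<^sup>2 * (\<Sum>i\<in>I. (c i)\<^sup>2) / 2))"
    using \<open>finite I\<close> by (simp add: std_normal_exp_moment prod_ennreal sum_distrib_left
        sum_divide_distrib power_mult_distrib flip: exp_sum)
  also have "ennreal (exp (- s * t)) * \<dots> = ennreal (exp (- s * t + s\<^sup>2 * (\<Sum>i\<in>I. (c i)\<^sup>2) / 2))"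
    by (simp flip: ennreal_mult exp_add)
  also have "\<dots> \<le> ennreal (exp (- t\<^sup>2 / (2 * V)))"
  proof -
    have "s\<^sup>2 * (\<Sum>i\<in>I. (c i)\<^sup>2) / 2 \<le> s\<^sup>2 * V / 2"
      using assms by (intro divide_right_mono mult_left_mono) auto
    moreover have "- s * t + s\<^sup>2 * V / 2 = - t\<^sup>2 / (2 * V)"
      using \<open>0 < V\<close> by (simp add: s_def power2_eq_square field_simps)
    ultimately show ?thesis by (intro ennreal_leI) simp
  qed
  finally show ?thesis by (simp add: N.emeasure_eq_measure)
qed


section \<open>Unfoldings and symmetrization\<close>

lemma finite_tensor_index: "finite (tensor_index n k)"
  unfolding tensor_index_def by (rule finite_lists_length_eq) simp

lemma length_tensor_index: "is \<in> tensor_index n k \<Longrightarrow> length is = k"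
  by (simp add: tensor_index_def)

lemma index_of_pos_Suc: "index_of_pos n (Suc m) a = (a mod n) # index_of_pos n m (a div n)"
  unfolding index_of_pos_def map_upt_Suc by (simp add: div_mult2_eq)

lemma index_of_pos_in_tensor_index: "0 < n \<Longrightarrow> index_of_pos n m a \<in> tensor_index n m"
  by (auto simp: index_of_pos_def tensor_index_def)

lemma index_pos_index_of_pos: "a < n ^ m \<Longrightarrow> index_pos n (index_of_pos n m a) = a"
proof (induction m arbitrary: a)
  case 0
  then show ?case by (simp add: index_of_pos_def)
next
  case (Suc m)
  then have "a div n < n ^ m" by (simp add: less_mult_imp_div_less mult.commute)
  then show ?case using Suc.IH by (simp add: index_of_pos_Suc index_pos_Cons)
qed

text \<open>Digit expansion is a bijection between positions and multi-indices; it converts sums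
  over rows or columns into sums over indices.\<close>

lemma sum_index_of_pos:
  assumes "0 < n"
  shows "(\<Sum>a<n ^ m. f (index_of_pos n m a)) = (\<Sum>is\<in>tensor_index n m. f is)"
  using assms
  by (intro sum.reindex_bij_witness[of _ "index_pos n" "index_of_pos n m"])
    (auto simp: index_pos_index_of_pos index_of_pos_index_pos index_of_pos_in_tensor_index
      index_pos_less)

lemma sum_tensor_index_append:
  assumes "q \<le> k"
  shows "(\<Sum>l\<in>tensor_index n q. \<Sum>r\<in>tensor_index n (k - q). f l r)
    = (\<Sum>is\<in>tensor_index n k. f (take q is) (drop q is))"
  unfolding sum.cartesian_product
  using assms
  by (intro sum.reindex_bij_witness[of _ "\<lambda>is. (take q is, drop q is)" "\<lambda>(l, r). l @ r"])
    (auto simp: tensor_index_def dest: in_set_takeD in_set_dropD)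

text \<open>Expansion of a power of a sum over words. Applied to squared coordinates, it shows that
  tensor powers of unit vectors are unit vectors.\<close>

lemma sum_tensor_power:
  "(\<Sum>is\<in>tensor_index n m. \<Prod>i\<leftarrow>is. f i) = (\<Sum>i<n. f i :: real) ^ m"
proof (induction m)
  case 0
  have "tensor_index n 0 = {[]}" by (auto simp: tensor_index_def)
  then show ?case by simp
next
  case (Suc m)
  have "(\<Sum>is\<in>tensor_index n (Suc m). \<Prod>i\<leftarrow>is. f i)
      = (\<Sum>(i, is)\<in>{..<n} \<times> tensor_index n m. f i * (\<Prod>i\<leftarrow>is. f i))"
    by (rule sum.reindex_bij_witness[of _ "\<lambda>(i, is). i # is" "\<lambda>is. (hd is, tl is)"])
      (auto simp: tensor_index_def length_Suc_conv)
  also have "\<dots> = (\<Sum>i<n. f i) * (\<Sum>is\<in>tensor_index n m. \<Prod>i\<leftarrow>is. f i)"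
    by (simp add: sum_product sum.cartesian_product)
  finally show ?case using Suc by simp
qed

lemma vectorize_tensor_power_unit:
  assumes "v \<in> unit_sphere n" "0 < n"
  shows "vectorize n m (tensor_power v) \<in> unit_sphere (n ^ m)"
proof -
  have v: "(\<Sum>i<n. (v $ i)\<^sup>2) = 1"
    using assms by (auto simp: unit_sphere_def simp flip: vnorm_square_sum)
  have sq: "(tensor_power v is)\<^sup>2 = (\<Prod>i\<leftarrow>is. (v $ i)\<^sup>2)" for "is"
    by (induction "is") (auto simp: tensor_power_def power_mult_distrib)
  have "vectorize n m (tensor_power v) \<bullet> vectorize n m (tensor_power v)
      = (\<Sum>a<n ^ m. (tensor_power v (index_of_pos n m a))\<^sup>2)"
    by (simp add: vectorize_def scalar_prod_def atLeast0LessThan power2_eq_square)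
  also have "\<dots> = 1" using \<open>0 < n\<close>
    by (simp only: sum_index_of_pos[where f = "\<lambda>is. (tensor_power v is)\<^sup>2"])
      (simp add: sq sum_tensor_power v)
  finally show ?thesis by (simp add: unit_sphere_def vnorm_def vectorize_def)
qed

section \<open>Bilinear forms of an unfolding\<close>

lemma Mat_carrier [simp]: "Mat n k q T \<in> carrier_mat (n ^ q) (n ^ (k - q))"
  by (simp add: Mat_def)

lemma scalar_prod_mult_mat_vec_sum:
  fixes A :: "real mat"
  assumes A: "A \<in> carrier_mat m n" and x: "x \<in> carrier_vec m" and y: "y \<in> carrier_vec n"
  shows "x \<bullet> (A *\<^sub>v y) = (\<Sum>a<m. \<Sum>c<n. x $ a * y $ c * A $$ (a, c))"
proof -
  have "x \<bullet> (A *\<^sub>v y) = (\<Sum>a<m. x $ a * (row A a \<bullet> y))"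
    using A scalar_prod_sum[OF x mult_mat_vec_carrier[OF A y]] by simp
  also have "\<dots> = (\<Sum>a<m. x $ a * (\<Sum>c<n. A $$ (a, c) * y $ c))"
    using A y by (intro sum.cong refl) (simp add: scalar_prod_sum[of _ n])
  finally show ?thesis by (simp add: sum_distrib_left mult_ac)
qed

lemma scalar_prod_Mat:
  assumes "x \<in> carrier_vec (n ^ q)" "y \<in> carrier_vec (n ^ (k - q))"
  shows "x \<bullet> (Mat n k q T *\<^sub>v y) = (\<Sum>a<n ^ q. \<Sum>c<n ^ (k - q).
    x $ a * y $ c * T (index_of_pos n q a @ index_of_pos n (k - q) c))"
  unfolding scalar_prod_mult_mat_vec_sum[OF Mat_carrier assms] by (simp add: Mat_def)

text \<open>The tensor whose unfolding is the rank-one matrix with entries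
  \<open>x $ a * y $ c\<close>.\<close>

definition outer :: "nat \<Rightarrow> nat \<Rightarrow> real vec \<Rightarrow> real vec \<Rightarrow> tensor" where
  "outer n q x y = (\<lambda>is. x $ index_pos n (take q is) * y $ index_pos n (drop q is))"

text \<open>Exhibits the bilinear form as an entrywise pairing of tensors, where symmetrization can
  be moved from one factor to the other.\<close>

lemma scalar_prod_Mat_outer:
  assumes "x \<in> carrier_vec (n ^ q)" "y \<in> carrier_vec (n ^ (k - q))" "0 < n" "q \<le> k"
  shows "x \<bullet> (Mat n k q T *\<^sub>v y) = (\<Sum>is\<in>tensor_index n k. outer n q x y is * T is)"
proof -
  let ?f = "\<lambda>l r. x $ index_pos n l * y $ index_pos n r * T (l @ r)"
  have "x \<bullet> (Mat n k q T *\<^sub>v y)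
      = (\<Sum>a<n ^ q. \<Sum>c<n ^ (k - q). ?f (index_of_pos n q a) (index_of_pos n (k - q) c))"
    using assms by (simp add: scalar_prod_Mat index_pos_index_of_pos)
  also have "\<dots> = (\<Sum>l\<in>tensor_index n q. \<Sum>r\<in>tensor_index n (k - q). ?f l r)"
    by (simp only: sum_index_of_pos[OF \<open>0 < n\<close>, where f = "?f _"]
        sum_index_of_pos[OF \<open>0 < n\<close>, where f = "\<lambda>l. \<Sum>r\<in>_. ?f l r"])
  also have "\<dots> = (\<Sum>is\<in>tensor_index n k. outer n q x y is * T is)"
    by (simp add: sum_tensor_index_append[OF \<open>q \<le> k\<close>] outer_def)
  finally show ?thesis .
qed

lemma sum_outer_square:
  assumes "x \<in> carrier_vec (n ^ q)" "y \<in> carrier_vec (n ^ (k - q))" "0 < n" "q \<le> k"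
  shows "(\<Sum>is\<in>tensor_index n k. (outer n q x y is)\<^sup>2) = (vnorm x)\<^sup>2 * (vnorm y)\<^sup>2"
proof -
  let ?f = "\<lambda>l. (x $ index_pos n l)\<^sup>2" and ?g = "\<lambda>r. (y $ index_pos n r)\<^sup>2"
  have "(\<Sum>is\<in>tensor_index n k. (outer n q x y is)\<^sup>2)
      = (\<Sum>l\<in>tensor_index n q. \<Sum>r\<in>tensor_index n (k - q). ?f l * ?g r)"
    by (simp add: sum_tensor_index_append[OF \<open>q \<le> k\<close>] outer_def power_mult_distrib)
  also have "\<dots> = (\<Sum>l\<in>tensor_index n q. ?f l) * (\<Sum>r\<in>tensor_index n (k - q). ?g r)"
    by (simp add: sum_product)
  also have "\<dots> = (\<Sum>a<n ^ q. ?f (index_of_pos n q a)) *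
      (\<Sum>c<n ^ (k - q). ?g (index_of_pos n (k - q) c))"
    by (simp only: sum_index_of_pos[OF \<open>0 < n\<close>, where f = ?f]
        sum_index_of_pos[OF \<open>0 < n\<close>, where f = ?g])
  also have "\<dots> = (vnorm x)\<^sup>2 * (vnorm y)\<^sup>2"
    using assms by (simp add: vnorm_square_sum index_pos_index_of_pos)
  finally show ?thesis .
qed

section \<open>Symmetrization over permutations of the positions\<close>

lemma permute_list_inverse:
  assumes "\<pi> permutes {..<length xs}"
  shows "permute_list (inv_into UNIV \<pi>) (permute_list \<pi> xs) = xs"
    "permute_list \<pi> (permute_list (inv_into UNIV \<pi>) xs) = xs"
  using permute_list_compose[of "inv_into UNIV \<pi>" xs \<pi>] permute_list_compose[of \<pi> xs "inv_into UNIV \<pi>"]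
    permutes_inv[OF assms] permutes_inv_o[OF assms] assms by auto

lemma permute_list_in_tensor_index:
  assumes "\<pi> permutes {..<k}" "is \<in> tensor_index n k"
  shows "permute_list \<pi> is \<in> tensor_index n k"
  using assms by (auto simp: tensor_index_def)

lemma bij_betw_permute_list:
  assumes "\<pi> permutes {..<k}"
  shows "bij_betw (permute_list \<pi>) (tensor_index n k) (tensor_index n k)"
  using assms permutes_inv[OF assms]
  by (intro bij_betwI[where g = "permute_list (inv_into UNIV \<pi>)"])
    (auto simp: permute_list_in_tensor_index permute_list_inverse length_tensor_index)

text \<open>Reindexing by \<open>\<pi>\<close> moves its inverse onto the other factor, and the sum
  over all permutations is invariant under inversion. With \<open>T\<close> deterministic, this
  displays the coefficients of a linear form in the i.i.d. entries of \<open>G\<close>.\<close>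

lemma sym_noise_self_adjoint:
  "(\<Sum>is\<in>tensor_index n k. T is * sym_noise n k G is)
    = (\<Sum>is\<in>tensor_index n k. sym_noise n k T is * G is)"
proof -
  let ?I = "tensor_index n k" and ?P = "{\<pi>. \<pi> permutes {..<k}}"
  have "(\<Sum>\<pi>\<in>?P. \<Sum>is\<in>?I. T is * G (permute_list \<pi> is))
      = (\<Sum>\<pi>\<in>?P. \<Sum>is\<in>?I. T (permute_list (inv_into UNIV \<pi>) is) * G is)"
  proof (rule sum.cong[OF refl])
    fix \<pi> assume "\<pi> \<in> ?P"
    then have \<pi>: "\<pi> permutes {..<k}" by simp
    have "(\<Sum>is\<in>?I. T (permute_list (inv_into UNIV \<pi>) is) * G is)
        = (\<Sum>is\<in>?I. T (permute_list (inv_into UNIV \<pi>) (permute_list \<pi> is)) * G (permute_list \<pi> is))"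
      by (rule sum.reindex_bij_betw[OF bij_betw_permute_list[OF \<pi>], symmetric])
    also have "\<dots> = (\<Sum>is\<in>?I. T is * G (permute_list \<pi> is))"
      using \<pi> by (intro sum.cong) (auto simp: permute_list_inverse length_tensor_index)
    finally show "(\<Sum>is\<in>?I. T is * G (permute_list \<pi> is))
        = (\<Sum>is\<in>?I. T (permute_list (inv_into UNIV \<pi>) is) * G is)" by simp
  qed
  also have "\<dots> = (\<Sum>\<pi>\<in>?P. \<Sum>is\<in>?I. T (permute_list \<pi> is) * G is)"
    by (rule sum_permutations_inverse[symmetric])
  finally have "(\<Sum>is\<in>?I. T is * (\<Sum>\<pi>\<in>?P. G (permute_list \<pi> is)))
      = (\<Sum>is\<in>?I. (\<Sum>\<pi>\<in>?P. T (permute_list \<pi> is)) * G is)"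
    unfolding sum_distrib_left sum_distrib_right by (subst (1 2) sum.swap)
  then have "1 / fact k * sqrt (real k / real n) * (\<Sum>is\<in>?I. T is * (\<Sum>\<pi>\<in>?P. G (permute_list \<pi> is)))
      = 1 / fact k * sqrt (real k / real n) * (\<Sum>is\<in>?I. (\<Sum>\<pi>\<in>?P. T (permute_list \<pi> is)) * G is)"
    by simp
  then show ?thesis unfolding sym_noise_def sum_distrib_left[of _ _ ?I]
    by (simp only: mult_ac)
qed

text \<open>Cauchy-Schwarz over the permutations costs a factor \<open>fact k\<close>, and each of
  the \<open>fact k\<close> terms has the norm of \<open>T\<close>; both factors cancel against the
  normalization, leaving \<open>k / n\<close>.\<close>

lemma sum_sym_noise_square_le:
  "(\<Sum>is\<in>tensor_index n k. (sym_noise n k T is)\<^sup>2)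
    \<le> real k / real n * (\<Sum>is\<in>tensor_index n k. (T is)\<^sup>2)"
proof -
  let ?I = "tensor_index n k" and ?P = "{\<pi>. \<pi> permutes {..<k}}"
  have card: "card ?P = fact k" by (rule card_permutations) auto
  have "(\<Sum>is\<in>?I. (sym_noise n k T is)\<^sup>2)
      = real k / real n / (fact k)\<^sup>2 * (\<Sum>is\<in>?I. (\<Sum>\<pi>\<in>?P. T (permute_list \<pi> is))\<^sup>2)"
    unfolding sym_noise_def power_mult_distrib sum_distrib_left[symmetric]
    by (simp add: power_divide)
  also have "\<dots> \<le> real k / real n / (fact k)\<^sup>2 *
      (\<Sum>is\<in>?I. (\<Sum>\<pi>\<in>?P. (T (permute_list \<pi> is))\<^sup>2) * fact k)"
    using sum_squared_le_sum_of_squares[where I = ?P] card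
    by (intro mult_left_mono sum_mono) auto
  also have "(\<Sum>is\<in>?I. (\<Sum>\<pi>\<in>?P. (T (permute_list \<pi> is))\<^sup>2) * fact k)
      = fact k * (\<Sum>\<pi>\<in>?P. \<Sum>is\<in>?I. (T (permute_list \<pi> is))\<^sup>2)"
    by (subst sum.swap) (simp add: sum_distrib_left mult.commute)
  also have "(\<Sum>\<pi>\<in>?P. \<Sum>is\<in>?I. (T (permute_list \<pi> is))\<^sup>2) = (\<Sum>\<pi>\<in>?P. \<Sum>is\<in>?I. (T is)\<^sup>2)"
    by (intro sum.cong refl sum.reindex_bij_betw bij_betw_permute_list) simp
  also have "\<dots> = fact k * (\<Sum>is\<in>?I. (T is)\<^sup>2)" by (simp add: card)
  finally show ?thesis by (simp add: power2_eq_square)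
qed

text \<open>The tensor power is multiplicative under concatenation of index lists, so the unfolded
  spike has rank one.\<close>

lemma scalar_prod_Mat_spiked:
  assumes "x \<in> carrier_vec (n ^ q)" "y \<in> carrier_vec (n ^ (k - q))"
  shows "x \<bullet> (Mat n k q (spiked_tensor n k \<beta> v G) *\<^sub>v y)
    = \<beta> * (x \<bullet> vectorize n q (tensor_power v)) * (vectorize n (k - q) (tensor_power v) \<bullet> y)
      + x \<bullet> (Mat n k q (sym_noise n k G) *\<^sub>v y)"
proof -
  let ?u = "vectorize n q (tensor_power v)" and ?w = "vectorize n (k - q) (tensor_power v)"
  have "\<beta> * (x \<bullet> ?u) * (?w \<bullet> y)
      = \<beta> * ((\<Sum>a<n ^ q. x $ a * ?u $ a) * (\<Sum>c<n ^ (k - q). ?w $ c * y $ c))"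
    using scalar_prod_sum[OF assms(1), of ?u] scalar_prod_sum[OF _ assms(2), of ?w]
    by (simp add: vectorize_def)
  also have "\<dots> = (\<Sum>a<n ^ q. \<Sum>c<n ^ (k - q). \<beta> * ((x $ a * ?u $ a) * (?w $ c * y $ c)))"
    unfolding sum_product by (simp add: sum_distrib_left)
  also have "\<dots> = (\<Sum>a<n ^ q. \<Sum>c<n ^ (k - q). x $ a * y $ c *
          (\<beta> * tensor_power v (index_of_pos n q a @ index_of_pos n (k - q) c)))"
    by (intro sum.cong refl) (simp add: vectorize_def tensor_power_def)
  finally have "\<beta> * (x \<bullet> ?u) * (?w \<bullet> y) = (\<Sum>a<n ^ q. \<Sum>c<n ^ (k - q). x $ a * y $ c *
          (\<beta> * tensor_power v (index_of_pos n q a @ index_of_pos n (k - q) c)))" .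
  then show ?thesis
    using assms by (simp add: scalar_prod_Mat spiked_tensor_def distrib_left sum.distrib)
qed


section \<open>Operator norm of the unfolded noise\<close>

lemma prob_space_gaussian_tensor: "prob_space (gaussian_tensor n k)"
  unfolding gaussian_tensor_def
  by (intro prob_space_PiM prob_space_normal_density) simp

lemma measurable_Mat_sym_noise:
  assumes "x \<in> carrier_vec (n ^ q)" "y \<in> carrier_vec (n ^ (k - q))" "0 < n" "q \<le> k"
  shows "(\<lambda>G. x \<bullet> (Mat n k q (sym_noise n k G) *\<^sub>v y)) \<in> borel_measurable (gaussian_tensor n k)"
  unfolding scalar_prod_Mat_outer[OF assms] sym_noise_self_adjoint gaussian_tensor_def
  by measurable

text \<open>The coefficients are those of the symmetrized outer product of \<open>x\<close> and
  \<open>y\<close>, so the variance is at most \<open>k / n\<close> on the unit balls.\<close>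

lemma Mat_sym_noise_tail:
  assumes x: "x \<in> carrier_vec (n ^ q)" "vnorm x \<le> 1" and y: "y \<in> carrier_vec (n ^ (k - q))" "vnorm y \<le> 1"
    and "0 < n" "q \<le> k" "0 < k" "0 < t"
  shows "measure (gaussian_tensor n k)
      {G \<in> space (gaussian_tensor n k). t \<le> x \<bullet> (Mat n k q (sym_noise n k G) *\<^sub>v y)}
    \<le> exp (- t\<^sup>2 / (2 * (real k / real n)))"
  unfolding scalar_prod_Mat_outer[OF x(1) y(1) \<open>0 < n\<close> \<open>q \<le> k\<close>] sym_noise_self_adjoint
    gaussian_tensor_def
proof (rule gaussian_linear_form_tail[OF finite_tensor_index \<open>0 < t\<close>])
  have "(vnorm x)\<^sup>2 * (vnorm y)\<^sup>2 \<le> 1 * 1"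
    using x y by (intro mult_mono) (auto simp: abs_square_le_1)
  then have "(\<Sum>is\<in>tensor_index n k. (outer n q x y is)\<^sup>2) \<le> 1"
    using sum_outer_square[OF x(1) y(1) \<open>0 < n\<close> \<open>q \<le> k\<close>] by simp
  then have "real k / real n * (\<Sum>is\<in>tensor_index n k. (outer n q x y is)\<^sup>2) \<le> real k / real n * 1"
    by (intro mult_left_mono) auto
  then show "(\<Sum>is\<in>tensor_index n k. (sym_noise n k (outer n q x y) is)\<^sup>2) \<le> real k / real n"
    using sum_sym_noise_square_le[of n k "outer n q x y"] by linarith
  show "0 < real k / real n" using \<open>0 < k\<close> \<open>0 < n\<close> by simp
qed

text \<open>The net is searched at level \<open>9 \<surd>(k n^(q - 1))\<close>, where each tail is at most
  \<open>exp (- 40 n^q)\<close>; there are at most \<open>2^(36 n^q)\<close> pairs of net points.\<close>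

lemma Mat_sym_noise_bound:
  assumes "0 < n" "0 < q" "q \<le> k" "k - q \<le> q"
  shows "\<exists>E\<in>sets (gaussian_tensor n k). measure (gaussian_tensor n k) E \<ge> 1 - 1 / (real n)\<^sup>2 \<and>
    (\<forall>G\<in>E. \<forall>x\<in>carrier_vec (n ^ q). \<forall>y\<in>carrier_vec (n ^ (k - q)).
      \<bar>x \<bullet> (Mat n k q (sym_noise n k G) *\<^sub>v y)\<bar>
        \<le> 18 * sqrt (real k * real n ^ (q - 1)) * vnorm x * vnorm y)"
proof -
  let ?N = "gaussian_tensor n k"
  let ?f = "\<lambda>x y G. x \<bullet> (Mat n k q (sym_noise n k G) *\<^sub>v y)"
  interpret prob_space ?N by (rule prob_space_gaussian_tensor)
  define t where "t = 9 * sqrt (real k * real n ^ (q - 1))"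
  define P where "P = grid_net (n ^ q) \<times> grid_net (n ^ (k - q))"
  define B where "B p = {G \<in> space ?N. t \<le> ?f (fst p) (snd p) G}" for p
  define E where "E = space ?N - (\<Union>p\<in>P. B p)"
  have "0 < k" using assms by linarith
  then have "0 < t" using \<open>0 < n\<close> by (simp add: t_def)
  have finP: "finite P" by (simp add: P_def finite_grid_net)
  have B_sets: "B p \<in> events" if "p \<in> P" for p
  proof -
    have [measurable]: "?f (fst p) (snd p) \<in> borel_measurable ?N"
      using that assms by (intro measurable_Mat_sym_noise) (auto simp: P_def grid_net_carrier)
    show ?thesis unfolding B_def by measurable
  qed
  have "real (card P) \<le> 2 ^ (36 * n ^ q)"
  proof -
    \<comment> \<open>The column net obeys the cardinality bound of the row net, so the exponents
      add up to \<open>2 * 18 = 36\<close>.\<close>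
    have "n ^ (k - q) \<le> n ^ q" using assms by (intro power_increasing) auto
    then have "(2 :: nat) ^ (18 * n ^ (k - q)) \<le> 2 ^ (18 * n ^ q)" by (intro power_increasing) auto
    then have "card P \<le> 2 ^ (18 * n ^ q) * 2 ^ (18 * n ^ q)"
      unfolding P_def card_cartesian_product
      by (intro mult_mono order_trans[OF card_grid_net]) auto
    also have "\<dots> = 2 ^ (36 * n ^ q)" by (simp flip: power_add)
    finally have "real (card P) \<le> real (2 ^ (36 * n ^ q))" by (rule of_nat_mono)
    then show ?thesis by simp
  qed
  also have "(2 :: real) ^ (36 * n ^ q) \<le> exp 1 ^ (36 * n ^ q)"
    using exp_ge_add_one_self[of 1] by (intro power_mono) auto
  also have "\<dots> = exp (36 * real (n ^ q))" by (simp flip: exp_of_nat_mult)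
  finally have cardP: "real (card P) \<le> exp (36 * real (n ^ q))" .
  have tail: "prob (B p) \<le> exp (- 40 * real (n ^ q))" if "p \<in> P" for p
  proof -
    \<comment> \<open>Relative to the variance bound \<open>k / n\<close>, the squared level is
      \<open>81 * n ^ q\<close>; the exponent \<open>81 / 2\<close> exceeds the \<open>36\<close> of
      the net count.\<close>
    have "real n * real n ^ (q - 1) = real n ^ q" using \<open>0 < q\<close> by (simp flip: power_Suc)
    then have "t\<^sup>2 = 81 * (real k / real n) * real (n ^ q)"
      using \<open>0 < n\<close> by (simp add: t_def power_mult_distrib field_simps)
    then have "- t\<^sup>2 / (2 * (real k / real n)) = - (81 / 2) * real (n ^ q)"
      using \<open>0 < n\<close> \<open>0 < k\<close> by (simp add: field_simps)
    also have "\<dots> \<le> - 40 * real (n ^ q)" by simp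
    finally have "- t\<^sup>2 / (2 * (real k / real n)) \<le> - 40 * real (n ^ q)" .
    moreover have "prob (B p) \<le> exp (- t\<^sup>2 / (2 * (real k / real n)))"
      unfolding B_def using that assms \<open>0 < t\<close> \<open>0 < k\<close>
      by (intro Mat_sym_noise_tail) (auto simp: P_def grid_net_carrier vnorm_grid_net)
    ultimately show ?thesis by (meson exp_le_cancel_iff order_trans)
  qed
  have U: "(\<Union>p\<in>P. B p) \<in> events" using finP B_sets by blast
  have "prob (\<Union>p\<in>P. B p) \<le> (\<Sum>p\<in>P. prob (B p))"
    using finP B_sets by (intro finite_measure_subadditive_finite) auto
  also have "\<dots> \<le> (\<Sum>p\<in>P. exp (- 40 * real (n ^ q)))" by (intro sum_mono tail)
  also have "\<dots> \<le> exp (36 * real (n ^ q)) * exp (- 40 * real (n ^ q))"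
    using cardP by (simp add: mult_right_mono)
  also have "\<dots> = exp (- 4 * real (n ^ q))" by (simp flip: exp_add)
  \<comment> \<open>The polynomial rate follows from \<open>n \<le> n ^ q\<close> and
    \<open>n \<le> exp n\<close>.\<close>
  also have "\<dots> \<le> exp (- 2 * real n)"
  proof -
    have "n \<le> n ^ q" using \<open>0 < n\<close> \<open>0 < q\<close> self_le_power[of n q] by simp
    then have "real n \<le> real (n ^ q)" by (rule of_nat_mono)
    then have "- 4 * real (n ^ q) \<le> - 2 * real n" by linarith
    then show ?thesis by (simp only: exp_le_cancel_iff)
  qed
  also have "\<dots> = 1 / (exp (real n))\<^sup>2"
    by (simp add: exp_minus field_simps flip: exp_double)
  also have "\<dots> \<le> 1 / (real n)\<^sup>2"
  proof -
    have "real n \<le> exp (real n)" using exp_ge_add_one_self[of "real n"] by linarith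
    then show ?thesis using \<open>0 < n\<close> by (intro divide_left_mono power_mono) auto
  qed
  finally have "prob E \<ge> 1 - 1 / (real n)\<^sup>2"
    unfolding E_def using prob_compl[OF U] by simp
  moreover have "E \<in> events" unfolding E_def using U by blast
  moreover have "\<bar>?f x y G\<bar> \<le> 18 * sqrt (real k * real n ^ (q - 1)) * vnorm x * vnorm y"
    if "G \<in> E" "x \<in> carrier_vec (n ^ q)" "y \<in> carrier_vec (n ^ (k - q))" for G x y
  proof -
    \<comment> \<open>Outside the bad events every net value is below \<open>t\<close>; passing to
      all vectors doubles it, so \<open>9\<close> becomes \<open>18\<close>.\<close>
    have "?f x' y' G \<le> t" if "x' \<in> grid_net (n ^ q)" "y' \<in> grid_net (n ^ (k - q))" for x' y'
      using \<open>G \<in> E\<close> that by (force simp: E_def P_def B_def)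
    then have "\<bar>?f x y G\<bar> \<le> 2 * t * vnorm x * vnorm y"
      using that \<open>0 < n\<close> by (intro bilinear_bound_from_grid_net[OF Mat_carrier]) auto
    then show ?thesis by (simp add: t_def)
  qed
  ultimately show ?thesis by blast
qed

section \<open>Combining the perturbation bound with the noise bound\<close>

theorem theorem4:
  fixes k :: nat and b :: real
  assumes "2 \<le> k" and "b = 1 / 2 * (real ((k + 1) div 2) - 1)"
  shows "\<exists>C>0. \<forall>(n :: nat) (v\<^sub>0 :: real vec) (\<beta> :: real) (w :: tensor \<Rightarrow> real vec).
    v\<^sub>0 \<in> unit_sphere n \<longrightarrow>
    (\<forall>X. top_right_singular_vector (Mat n k ((k + 1) div 2) X) (w X)) \<longrightarrow>
    5 * sqrt (real k) * real n powr b \<le> \<beta> \<longrightarrow>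
    (\<exists>E \<in> sets (gaussian_tensor n k).
       measure (gaussian_tensor n k) E \<ge> 1 - 1 / (real n)\<^sup>2 \<and>
       (\<forall>G\<in>E. Loss (w (spiked_tensor n k \<beta> v\<^sub>0 G)) (vectorize n (k div 2) (tensor_power v\<^sub>0))
                \<le> C * real k * real n powr (2 * b) / \<beta>\<^sup>2))"
\<comment> \<open>The constant is \<open>8 * 18\<^sup>2\<close>: \<open>8\<close> from the
  perturbation bound and \<open>18\<close> from the noise bound. It serves every
  \<open>k\<close>.\<close>
proof (intro exI[of _ "2592 :: real"] conjI allI impI)
  fix n :: nat and v\<^sub>0 :: "real vec" and \<beta> :: real and w :: "tensor \<Rightarrow> real vec"
  assume v: "v\<^sub>0 \<in> unit_sphere n"
    and top: "\<forall>X. top_right_singular_vector (Mat n k ((k + 1) div 2) X) (w X)"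
    and \<beta>: "5 * sqrt (real k) * real n powr b \<le> \<beta>"
  define q where "q = (k + 1) div 2"
  have q: "0 < q" "q \<le> k" "k - q = k div 2" "k - q \<le> q" using \<open>2 \<le> k\<close> by (auto simp: q_def)
  \<comment> \<open>In dimension \<open>0\<close> the unit sphere is empty.\<close>
  have n: "0 < n"
    using v by (cases "n = 0") (auto simp: unit_sphere_def vnorm_eq_L2_set[of _ 0])
  have "0 < 5 * sqrt (real k) * real n powr b" using n \<open>2 \<le> k\<close> by simp
  then have "0 < \<beta>" using \<beta> by linarith
  define \<epsilon> where "\<epsilon> = 18 * sqrt (real k * real n ^ (q - 1))"
  \<comment> \<open>With \<open>q\<close> the ceiling of \<open>k / 2\<close>, the real power in the
    claim is the natural power \<open>n ^ (q - 1)\<close> of the noise bound.\<close>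
  have "2 * b = real (q - 1)" using q assms(2) by (simp add: q_def of_nat_diff)
  then have "real n powr (2 * b) = real n ^ (q - 1)" using n by (simp add: powr_realpow)
  then have \<epsilon>: "8 * \<epsilon>\<^sup>2 = 2592 * real k * real n powr (2 * b)"
    by (simp add: \<epsilon>_def power_mult_distrib)
  obtain E where E: "E \<in> sets (gaussian_tensor n k)"
    "measure (gaussian_tensor n k) E \<ge> 1 - 1 / (real n)\<^sup>2"
    and noise: "\<And>G x y. G \<in> E \<Longrightarrow> x \<in> carrier_vec (n ^ q) \<Longrightarrow> y \<in> carrier_vec (n ^ (k - q)) \<Longrightarrow>
      \<bar>x \<bullet> (Mat n k q (sym_noise n k G) *\<^sub>v y)\<bar> \<le> \<epsilon> * vnorm x * vnorm y"
    using Mat_sym_noise_bound[OF n q(1,2,4)] unfolding \<epsilon>_def by blast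
  \<comment> \<open>The event \<open>E\<close> concerns the noise alone; on it the bound is
    deterministic, with \<open>\<epsilon>\<close> as the size of the perturbation.\<close>
  have "Loss (w (spiked_tensor n k \<beta> v\<^sub>0 G)) (vectorize n (k - q) (tensor_power v\<^sub>0)) \<le> 8 * \<epsilon>\<^sup>2 / \<beta>\<^sup>2"
    if "G \<in> E" for G
  proof (rule Loss_top_right_singular_vector_le[OF Mat_carrier])
    show "top_right_singular_vector (Mat n k q (spiked_tensor n k \<beta> v\<^sub>0 G)) (w (spiked_tensor n k \<beta> v\<^sub>0 G))"
      using top by (simp add: q_def)
    show "vectorize n q (tensor_power v\<^sub>0) \<in> unit_sphere (n ^ q)"
      "vectorize n (k - q) (tensor_power v\<^sub>0) \<in> unit_sphere (n ^ (k - q))"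
      using v n by (auto intro: vectorize_tensor_power_unit)
  qed (use n \<open>0 < \<beta>\<close> noise[OF that] in \<open>auto simp: scalar_prod_Mat_spiked \<epsilon>_def\<close>)
  then show "\<exists>E \<in> sets (gaussian_tensor n k).
       measure (gaussian_tensor n k) E \<ge> 1 - 1 / (real n)\<^sup>2 \<and>
       (\<forall>G\<in>E. Loss (w (spiked_tensor n k \<beta> v\<^sub>0 G)) (vectorize n (k div 2) (tensor_power v\<^sub>0))
                \<le> 2592 * real k * real n powr (2 * b) / \<beta>\<^sup>2)"
    using E unfolding \<epsilon> q(3) by blast
qed simp

end
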